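(* Let $m,n\ge 1$, let $A\in\mathbb{R}^{m\times m}$, $B\in\mathbb{R}^{m\times n}$, $C\in\mathbb{R}^{n\times m}$, $D\in\mathbb{R}^{n\times n}$, and let $$K=\begin{bmatrix} D & -C\\ -B & A\end{bmatrix}$$ be a regular singular $M$-matrix whose null space is one-dimensional. Let $u_1,v_1\in\mathbb{R}^n$ and $u_2,v_2\in\mathbb{R}^m$ be such that $\begin{bmatrix} u_1 \\ u_2 \end{bmatrix}$ and $\begin{bmatrix} v_1 \\ v_2 \end{bmatrix}$ are nonnegative nonzero vectors with $$K\begin{bmatrix} v_1 \\ v_2 \end{bmatrix}=0,\qquad [u_1^T\ \ u_2^T]K=0.$$ Let $\Phi$ be the minimal nonnegative solution of $XCX-XD-AX+B=0$ and let $\Psi$ be the minimal nonnegative solution of $YBY-YA-DY+C=0$. Then: (i) If $u_1^Tv_1>u_2^Tv_2$, then $D-C\Phi$ is singular and $A-\Phi C$ is nonsingular, $\Phi v_1=v_2$, $\Psi v_2\ne v_1$, $u_1^T\Psi=u_2^T$, $u_2^T\Phi\ne u_1^T$. (ii) If $u_1^Tv_1<u_2^Tv_2$, then $D-C\Phi$ is nonsingular and $A-\Phi C$ is singular, $\Phi v_1\ne v_2$, $\Psi v_2=v_1$, $u_1^T\Psi\ne u_2^T$, $u_2^T\Phi=u_1^T$. (iii) If $u_1^Tv_1=u_2^Tv_2$, then $D-C\Phi$ and $A-\Phi C$ are both singular, $\Phi v_1=v_2$, $\Psi v_2=v_1$, $u_1^T\Psi=u_2^T$, $u_2^T\Ph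i=u_1^T$.
   Context: For real matrices or vectors of the same size, $A\ge B$ ($A>B$) means $a_{ij}\ge b_{ij}$ ($a_{ij}>b_{ij}$) for all $i,j$; a matrix or vector $X$ is nonnegative if $X\ge 0$. A real square matrix is a $Z$-matrix if all its off-diagonal entries are nonpositive; any $Z$-matrix can be written as $sI-N$ with $N\ge 0$. A $Z$-matrix $sI-N$ ($N\ge 0$) is an $M$-matrix if $s\ge\rho(N)$, where $\rho$ is the spectral radius; it is a singular $M$-matrix if $s=\rho(N)$. An $M$-matrix $A$ is regular if $Av\ge 0$ for some vector $v>0$. A minimal nonnegative solution of a matrix equation is a nonnegative solution that is entrywise $\le$ every nonnegative solution. The unknowns are $X\in\mathbb{R}^{m\times n}$ and $Y\in\mathbb{R}^{n\times m}$; when $K$ is a regular $M$-matrix, both minimal nonnegative solutions $\Phi$ and $\Psi$ exist. The null space of $K$ equals that of $H=\begin{bmatrix} D & -C\\ B & -A\end{bmatrix}$, so the null-space hypothesis says that $H$ has only one linearly independent eigenvector for the eigenvalue $0$; the vectors above exist and are unique up to positive scalar multiples. *)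

theory Defs
  imports "HOL-Analysis.Analysis"
begin

text \<open>
  The order \<open>\<le>\<close> on vectors and matrices is the componentwise one of the library. The library's \<open><\<close>
  on \<open>real ^ 'n\<close> is only the strict part of \<open>\<le>\<close>, so strict positivity of a vector is written out.
  Row-vector products \<open>u\<^sup>T M\<close> are \<open>u v* M\<close>, and \<open>mat s\<close> is the scalar matrix \<open>s I\<close>.
\<close>

definition block_vec :: "'a ^ 'n \<Rightarrow> 'a ^ 'm \<Rightarrow> 'a ^ ('n + 'm)" where
  "block_vec x y = (\<chi> i. case i of Inl a \<Rightarrow> x $ a | Inr b \<Rightarrow> y $ b)"

text \<open>The rows of \<open>block_matrix P Q R S\<close> are \<open>[P Q]\<close> and \<open>[R S]\<close>.\<close>

definition block_matrix ::
    "'a ^ 'n ^ 'k \<Rightarrow> 'a ^ 'm ^ 'k \<Rightarrow> 'a ^ 'n ^ 'l \<Rightarrow> 'a ^ 'm ^ 'l \<Rightarrow> 'a ^ ('n + 'm) ^ ('k + 'l)" where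
  "block_matrix P Q R S = (\<chi> i. case i of
      Inl a \<Rightarrow> block_vec (P $ a) (Q $ a)
    | Inr b \<Rightarrow> block_vec (R $ b) (S $ b))"

text \<open>Eigenvalues of a real matrix are taken over the complex numbers.\<close>

definition eigenvalues :: "real ^ 'n ^ 'n \<Rightarrow> complex set" where
  "eigenvalues A = {c. \<exists>x. x \<noteq> 0 \<and> map_matrix complex_of_real A *v x = c *s x}"

definition spectral_radius :: "real ^ 'n ^ 'n \<Rightarrow> real" where
  "spectral_radius A = Max (cmod ` eigenvalues A)"

text \<open>
  The matrices \<open>s I - N\<close> with \<open>N \<ge> 0\<close> are exactly the Z-matrices. Passing from \<open>(s, N)\<close> to another
  such representation \<open>(s + t, N + t I)\<close> of the same matrix leaves \<open>s - \<rho>(N)\<close> unchanged, so the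
  choice of representation is immaterial in the two definitions below.
\<close>

definition M_matrix :: "real ^ 'n ^ 'n \<Rightarrow> bool" where
  "M_matrix A \<longleftrightarrow> (\<exists>s N. 0 \<le> N \<and> A = mat s - N \<and> spectral_radius N \<le> s)"

definition singular_M_matrix :: "real ^ 'n ^ 'n \<Rightarrow> bool" where
  "singular_M_matrix A \<longleftrightarrow> (\<exists>s N. 0 \<le> N \<and> A = mat s - N \<and> s = spectral_radius N)"

definition regular_M_matrix :: "real ^ 'n ^ 'n \<Rightarrow> bool" where
  "regular_M_matrix A \<longleftrightarrow> M_matrix A \<and> (\<exists>v. (\<forall>i. 0 < v $ i) \<and> 0 \<le> A *v v)"

definition minimal_nonneg_solution ::
    "(real ^ 'n ^ 'm \<Rightarrow> real ^ 'n ^ 'm) \<Rightarrow> real ^ 'n ^ 'm \<Rightarrow> bool" where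
  "minimal_nonneg_solution F X \<longleftrightarrow>
     0 \<le> X \<and> F X = 0 \<and> (\<forall>Z. 0 \<le> Z \<and> F Z = 0 \<longrightarrow> X \<le> Z)"

end

theory Submission
  imports Defs
begin

text \<open>
  Write \<open>R = D - C \<Phi>\<close>, \<open>T = A - \<Phi> C\<close> and \<open>u = (u1, u2)\<close>, \<open>v = (v1, v2)\<close>. Everything is reduced to
  two statements on \<open>\<Phi>\<close>: \<open>R\<close> is singular if and only if \<open>\<Phi> v1 = v2\<close>, and \<open>\<Phi> v1 = v2\<close> if and
  only if \<open>u2 \<bullet> v2 \<le> u1 \<bullet> v1\<close>. The remaining assertions are these two for the transposed equation,
  which has solution \<open>\<Phi>\<close> transposed and exchanges the roles of \<open>u\<close> and \<open>v\<close> and of the two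
  blocks, and for the equation of \<open>\<Psi>\<close> and its transpose. Regularity of \<open>K\<close> is not preserved by
  transposition, so the argument covers matrices \<open>K\<close> such that \<open>K\<close> or its transpose is regular.

  The tool is \<open>minimal_solution_bound\<close>: if \<open>w \<ge> 0\<close> and \<open>K w \<ge> 0\<close> then \<open>\<Phi> w1 \<le> w2\<close>, because the
  bound is inherited by every step of the monotone iteration that converges to \<open>\<Phi>\<close>. In particular
  \<open>\<Phi> v1 \<le> v2\<close> and \<open>u2 \<Phi> \<le> u1\<close>.

  If \<open>R x = 0\<close> then \<open>K\<close> annihilates \<open>(x, \<Phi> x)\<close>, which is therefore a multiple of \<open>v\<close>; this gives
  the first statement. If \<open>\<Phi> v1 = v2\<close>, then \<open>u2 \<bullet> v2 = (u2 \<Phi>) \<bullet> v1 \<le> u1 \<bullet> v1\<close>.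

  Conversely, let \<open>u2 \<bullet> v2 \<le> u1 \<bullet> v1\<close> and suppose that \<open>d = v2 - \<Phi> v1\<close>, which is nonnegative, is not
  zero. Then \<open>R\<close> is nonsingular, and \<open>(u1 - u2 \<Phi>) R = 0\<close> gives \<open>u1 = u2 \<Phi>\<close>. Moreover \<open>T d = 0\<close>
  because \<open>K v = 0\<close>, \<open>u2 T = u2 A - u1 C = 0\<close>, and \<open>u2 \<bullet> d = u2 \<bullet> v2 - u1 \<bullet> v1 \<le> 0\<close>, so that
  \<open>u2 \<bullet> d = 0\<close>: \<open>d\<close> vanishes on the support of \<open>u2\<close>. This is impossible, but since
  \<open>u\<close> and \<open>v\<close> may have zero entries, strict positivity is not available. What replaces it is a
  comparison for Z-matrices (\<open>Z_matrix_no_kernel_on_support\<close>): a nonnegative null vector \<open>d\<close> of a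
  Z-matrix \<open>M\<close> is zero if there is \<open>e \<ge> 0\<close> for which \<open>M e\<close> is positive on the support of \<open>d\<close>.

  \<^item> If \<open>K\<close> is regular, say \<open>w > 0\<close> and \<open>K w \<ge> 0\<close>, the indicator of the zero set of \<open>u2\<close>, extended by
    zero to the first block, is orthogonal to \<open>u\<close> and hence of the form \<open>K z\<close>. Adding a large
    multiple of \<open>w\<close> to \<open>z\<close> gives \<open>z' \<ge> 0\<close>, and \<open>e = z'2 - \<Phi> z'1\<close> is nonnegative by the bound and
    has \<open>T e \<ge> 1\<close> on the zero set of \<open>u2\<close>, which contains the support of \<open>d\<close>. So \<open>d = 0\<close>.
  \<^item> If the transpose of \<open>K\<close> is regular, then \<open>w2 T \<ge> 0\<close> for some \<open>w2 > 0\<close>. The null space of \<open>T\<close> is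
    spanned by \<open>d\<close>, since \<open>R\<close> is onto and so null vectors of \<open>T\<close> lift to null vectors of \<open>K\<close>.
    Hence the indicator of the zero set of \<open>d\<close> is of the form \<open>y T\<close>. The comparison
    for the transpose of \<open>T\<close>, with null vector \<open>u2\<close> and \<open>e = y + c w2\<close> for large \<open>c\<close>, gives
    \<open>u2 = 0\<close>, hence \<open>u1 = u2 \<Phi> = 0\<close>.
\<close>

section \<open>Matrices and vectors\<close>

lemma matrix_vector_mult_nonneg:
  fixes P :: "real ^ 'k ^ 'l"
  assumes "0 \<le> P" "0 \<le> x"
  shows "0 \<le> P *v x"
  using assms by (auto simp: less_eq_vec_def matrix_vector_mult_def intro!: sum_nonneg)

lemma matrix_vector_mult_mono:
  fixes P :: "real ^ 'k ^ 'l"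
  assumes "0 \<le> P" "x \<le> y"
  shows "P *v x \<le> P *v y"
  using matrix_vector_mult_nonneg[of P "y - x"] assms
  by (simp add: matrix_vector_mult_diff_distrib)

lemma matrix_mult_mono:
  fixes P P' :: "real ^ 'k ^ 'l" and Q Q' :: "real ^ 'j ^ 'k"
  assumes "0 \<le> P" "P \<le> P'" "0 \<le> Q" "Q \<le> Q'"
  shows "P ** Q \<le> P' ** Q'"
proof -
  have "P $ i $ k * Q $ k $ j \<le> P' $ i $ k * Q' $ k $ j" for i j k
    using assms order_trans[OF assms(1,2)] by (intro mult_mono) (auto simp: less_eq_vec_def)
  then show ?thesis
    by (simp add: less_eq_vec_def matrix_matrix_mult_def sum_mono)
qed

lemma inner_nonneg_vec:
  fixes x y :: "real ^ 'k"
  assumes "0 \<le> x" "0 \<le> y"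
  shows "0 \<le> x \<bullet> y"
  using assms by (auto simp: inner_vec_def less_eq_vec_def intro!: sum_nonneg)

lemma inner_nonneg_eq_0D:
  fixes x y :: "real ^ 'k"
  assumes "0 \<le> x" "0 \<le> y" "x \<bullet> y = 0"
  shows "x $ i = 0 \<or> y $ i = 0"
proof -
  have "(\<Sum>i\<in>UNIV. x $ i * y $ i) = 0"
    using assms(3) by (simp add: inner_vec_def)
  moreover have "0 \<le> x $ i * y $ i" for i
    using assms(1,2) by (simp add: less_eq_vec_def)
  ultimately have "x $ i * y $ i = 0"
    by (simp add: sum_nonneg_eq_0_iff)
  then show ?thesis by simp
qed

lemma transpose_diff: "transpose (P - Q) = transpose P - transpose (Q :: real ^ 'k ^ 'l)"
  by (simp add: transpose_def vec_eq_iff)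

lemma transpose_add: "transpose (P + Q) = transpose P + transpose (Q :: real ^ 'k ^ 'l)"
  by (simp add: transpose_def vec_eq_iff)

lemma transpose_nonneg_iff: "0 \<le> transpose P \<longleftrightarrow> 0 \<le> (P :: real ^ 'k ^ 'l)"
  by (auto simp: transpose_def less_eq_vec_def)

lemma transpose_le_iff: "transpose P \<le> transpose Q \<longleftrightarrow> P \<le> (Q :: real ^ 'k ^ 'l)"
  by (auto simp: transpose_def less_eq_vec_def)

lemma invertible_iff_kernel:
  fixes M :: "real ^ 'k ^ 'k"
  shows "invertible M \<longleftrightarrow> (\<forall>x. M *v x = 0 \<longrightarrow> x = 0)"
  by (simp add: invertible_left_inverse matrix_left_invertible_ker)

lemma invertible_transpose_iff:
  fixes M :: "real ^ 'k ^ 'k"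
  shows "invertible (transpose M) \<longleftrightarrow> invertible M"
  by (simp add: invertible_det_nz det_transpose)

lemma dim_kernel_eq_transpose:
  fixes M :: "real ^ 'k ^ 'k"
  shows "dim {x. x v* M = 0} = dim {x. M *v x = 0}"
proof -
  have rank_nullity: "dim {x. N *v x = 0} + rank N = CARD('k)" for N :: "real ^ 'k ^ 'k"
  proof -
    let ?W = "range (\<lambda>x. transpose N *v x)"
    have "subspace ?W"
      by (intro linear_subspace_image matrix_vector_mul_linear subspace_UNIV)
    moreover have "{y \<in> UNIV. \<forall>x\<in>?W. orthogonal x y} = {x. N *v x = 0}"
    proof -
      have "(\<forall>x. (transpose N *v x) \<bullet> y = 0) \<longleftrightarrow> N *v y = 0" for y
      proof
        assume "\<forall>x. (transpose N *v x) \<bullet> y = 0"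
        then have "(N *v y) \<bullet> (N *v y) = 0"
          by (metis dot_lmul_matrix transpose_matrix_vector)
        then show "N *v y = 0" by simp
      qed (simp add: dot_lmul_matrix)
      then show ?thesis by (auto simp: orthogonal_def)
    qed
    moreover have "dim ?W = rank N"
      by (metis rank_dim_range rank_transpose)
    ultimately show ?thesis
      using dim_subspace_orthogonal_to_vectors[of ?W UNIV] by (simp add: dim_UNIV)
  qed
  have "{x. x v* M = 0} = {x. transpose M *v x = 0}" by simp
  then show ?thesis
    using rank_nullity[of M] rank_nullity[of "transpose M"] by (simp add: rank_transpose)
qed

lemma dim_1_multiple:
  fixes x z :: "'a::euclidean_space"
  assumes "dim S = 1" "z \<in> S" "z \<noteq> 0" "x \<in> S"
  shows "\<exists>c. x = c *\<^sub>R z"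
proof -
  have "S \<subseteq> span {z}"
    by (rule card_ge_dim_independent) (use assms in auto)
  then show ?thesis
    using assms(4) by (auto simp: span_singleton)
qed

text \<open>The case of the Fredholm alternative in which the left null space is spanned by one vector.\<close>

lemma solvable_if_orthogonal_left_kernel:
  fixes M :: "real ^ 'k ^ 'l" and b u :: "real ^ 'l"
  assumes ker: "\<And>z. z v* M = 0 \<Longrightarrow> \<exists>c. z = c *\<^sub>R u"
    and orth: "u \<bullet> b = 0"
  shows "\<exists>x. M *v x = b"
proof -
  let ?W = "range (\<lambda>x. M *v x)"
  have span: "span ?W = ?W"
    by (intro span_eq_iff[THEN iffD2] linear_subspace_image matrix_vector_mul_linear subspace_UNIV)
  obtain y z where y: "y \<in> ?W" and z: "\<And>w. w \<in> ?W \<Longrightarrow> orthogonal z w" and b: "b = y + z"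
    using orthogonal_subspace_decomp_exists[of ?W b] unfolding span by blast
  have "(z v* M) \<bullet> (z v* M) = 0"
    using z by (auto simp: orthogonal_def dot_lmul_matrix)
  then obtain c where c: "z = c *\<^sub>R u"
    using ker by auto
  have "z \<bullet> z = z \<bullet> b"
    using z[OF y] by (simp add: b inner_add_right orthogonal_def)
  also have "\<dots> = 0"
    using orth c by simp
  finally show ?thesis
    using y b by auto
qed

lemma eventually_nonneg_add_positive:
  fixes x w :: "real ^ 'k"
  assumes "\<forall>i. 0 < w $ i"
  shows "\<exists>c0. \<forall>c\<ge>c0. 0 \<le> x + c *\<^sub>R w"
proof (intro exI allI impI)
  fix c assume c: "(\<Sum>i\<in>UNIV. \<bar>x $ i\<bar> / w $ i) \<le> c"
  have "0 \<le> x $ i + c * w $ i" for i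
  proof -
    have "\<bar>x $ i\<bar> / w $ i \<le> (\<Sum>i\<in>UNIV. \<bar>x $ i\<bar> / w $ i)"
      using assms by (intro member_le_sum) (auto intro: divide_nonneg_pos)
    then have "\<bar>x $ i\<bar> / w $ i \<le> c"
      using c by linarith
    then have "\<bar>x $ i\<bar> \<le> c * w $ i"
      using assms by (simp add: divide_le_eq)
    then show ?thesis by linarith
  qed
  then show "0 \<le> x + c *\<^sub>R w"
    by (simp add: less_eq_vec_def)
qed

section \<open>Block vectors and block matrices\<close>

lemma block_vec_nth [simp]:
  "block_vec x y $ Inl a = x $ a" "block_vec x y $ Inr b = y $ b"
  by (simp_all add: block_vec_def)

lemma all_sum_iff: "(\<forall>i. P i) \<longleftrightarrow> (\<forall>a. P (Inl a)) \<and> (\<forall>b. P (Inr b))"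
  by (metis sum.exhaust)

lemma sum_UNIV_sum:
  fixes f :: "'a::finite + 'b::finite \<Rightarrow> 'c::comm_monoid_add"
  shows "sum f UNIV = (\<Sum>a\<in>UNIV. f (Inl a)) + (\<Sum>b\<in>UNIV. f (Inr b))"
  by (simp add: sum.Plus flip: UNIV_Plus_UNIV)

lemma block_vec_eq_iff: "block_vec x y = block_vec x' y' \<longleftrightarrow> x = x' \<and> y = y'"
  by (simp add: vec_eq_iff all_sum_iff)

lemma block_vec_eq_0_iff: "block_vec x y = 0 \<longleftrightarrow> x = 0 \<and> y = 0"
  by (simp add: vec_eq_iff all_sum_iff)

lemma block_vec_nonneg_iff:
  fixes x :: "real ^ 'n" and y :: "real ^ 'm"
  shows "0 \<le> block_vec x y \<longleftrightarrow> 0 \<le> x \<and> 0 \<le> y"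
  by (simp add: less_eq_vec_def all_sum_iff)

lemma block_vec_cases:
  obtains x y where "z = block_vec x y"
proof
  show "z = block_vec (\<chi> a. z $ Inl a) (\<chi> b. z $ Inr b)"
    by (simp add: vec_eq_iff all_sum_iff)
qed

lemma inner_block_vec:
  fixes x x' :: "real ^ 'n" and y y' :: "real ^ 'm"
  shows "block_vec x y \<bullet> block_vec x' y' = x \<bullet> x' + y \<bullet> y'"
  by (simp add: inner_vec_def sum_UNIV_sum)

lemma scaleR_block_vec:
  fixes x :: "real ^ 'n" and y :: "real ^ 'm"
  shows "c *\<^sub>R block_vec x y = block_vec (c *\<^sub>R x) (c *\<^sub>R y)"
  by (simp add: vec_eq_iff all_sum_iff)

lemma block_matrix_vector_mult:
  fixes A :: "real ^ 'm ^ 'm" and B :: "real ^ 'n ^ 'm"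
    and C :: "real ^ 'm ^ 'n" and D :: "real ^ 'n ^ 'n"
  shows "block_matrix D (- C) (- B) A *v block_vec x y =
    block_vec (D *v x - C *v y) (A *v y - B *v x)"
  by (simp add: vec_eq_iff all_sum_iff block_matrix_def matrix_vector_mult_def sum_UNIV_sum
      sum_negf)

lemma vector_block_matrix_mult:
  fixes A :: "real ^ 'm ^ 'm" and B :: "real ^ 'n ^ 'm"
    and C :: "real ^ 'm ^ 'n" and D :: "real ^ 'n ^ 'n"
  shows "block_vec x y v* block_matrix D (- C) (- B) A =
    block_vec (x v* D - y v* B) (y v* A - x v* C)"
  by (simp add: vec_eq_iff all_sum_iff block_matrix_def vector_matrix_mult_def sum_UNIV_sum
      sum_negf)

section \<open>Z-matrices\<close>

lemma Z_matrix_mult_nonpos: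
  fixes M :: "real ^ 'k ^ 'k"
  assumes Z: "\<And>i j. i \<noteq> j \<Longrightarrow> M $ i $ j \<le> 0"
    and "0 \<le> x" "x $ i = 0"
  shows "(M *v x) $ i \<le> 0"
proof -
  have "M $ i $ j * x $ j \<le> 0" for j
    using assms by (cases "i = j") (auto simp: less_eq_vec_def mult_le_0_iff)
  then show ?thesis
    by (simp add: matrix_vector_mult_def sum_nonpos)
qed

text \<open>Positivity of \<open>e\<close> on the support of \<open>d\<close> is not assumed: it follows from that of \<open>M e\<close>,
  because a Z-matrix maps \<open>e \<ge> 0\<close> to something nonpositive wherever \<open>e\<close> vanishes.\<close>

lemma Z_matrix_no_kernel_on_support:
  fixes M :: "real ^ 'k ^ 'k"
  assumes Z: "\<And>i j. i \<noteq> j \<Longrightarrow> M $ i $ j \<le> 0"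
    and d: "0 \<le> d" "M *v d = 0"
    and e: "0 \<le> e" "\<And>i. d $ i \<noteq> 0 \<Longrightarrow> 0 < (M *v e) $ i"
  shows "d = 0"
proof (rule ccontr)
  assume "d \<noteq> 0"
  define S where "S = {i. d $ i \<noteq> 0}"
  have S: "finite S" "S \<noteq> {}"
    using \<open>d \<noteq> 0\<close> by (auto simp: S_def vec_eq_iff)
  have e_pos: "0 < e $ i" if "i \<in> S" for i
  proof -
    have "e $ i \<noteq> 0"
      using Z_matrix_mult_nonpos[of M e i, OF Z e(1)] e(2)[of i] that by (auto simp: S_def)
    then show ?thesis
      using e(1) by (simp add: less_eq_vec_def order_less_le)
  qed
  define c where "c = Max ((\<lambda>i. d $ i / e $ i) ` S)"
  have "c \<in> (\<lambda>i. d $ i / e $ i) ` S"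
    unfolding c_def using S by (intro Max_in) auto
  then obtain i where i: "i \<in> S" "c = d $ i / e $ i" by blast
  have c_ge: "d $ j / e $ j \<le> c" if "j \<in> S" for j
    unfolding c_def using S that by (intro Max_ge) auto
  have d_nn: "0 \<le> d $ j" and e_nn: "0 \<le> e $ j" for j
    using d(1) e(1) by (simp_all add: less_eq_vec_def)
  have "0 < c"
    using i e_pos[OF i(1)] d_nn[of i] by (simp add: S_def order_less_le)
  \<comment> \<open>\<open>c e\<close> is the least multiple of \<open>e\<close> above \<open>d\<close>; it touches \<open>d\<close> at \<open>i\<close>.\<close>
  have "0 \<le> c * e $ j - d $ j" for j
  proof (cases "j \<in> S")
    case True
    then show ?thesis using c_ge[OF True] e_pos[OF True] by (simp add: field_simps)
  next
    case False
    then show ?thesis using \<open>0 < c\<close> e_nn[of j] by (simp add: S_def)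
  qed
  then have "0 \<le> c *\<^sub>R e - d"
    by (simp add: less_eq_vec_def)
  moreover have "(c *\<^sub>R e - d) $ i = 0"
    using i e_pos[OF i(1)] by simp
  ultimately have "(M *v (c *\<^sub>R e - d)) $ i \<le> 0"
    using Z by (intro Z_matrix_mult_nonpos)
  moreover have "(M *v (c *\<^sub>R e - d)) $ i = c * (M *v e) $ i"
    by (simp add: matrix_vector_mult_diff_distrib matrix_vector_mult_scaleR d(2))
  ultimately show False
    using e(2)[of i] i(1) \<open>0 < c\<close> by (simp add: S_def mult_le_0_iff)
qed

section \<open>The minimal solution of a Riccati equation\<close>

text \<open>The left-hand side of the equation. Exchanging \<open>A\<close> with \<open>D\<close> and \<open>B\<close> with \<open>C\<close> gives that of the
  equation for \<open>\<Psi>\<close>.\<close>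

abbreviation riccati ::
    "real ^ 'm ^ 'm \<Rightarrow> real ^ 'n ^ 'm \<Rightarrow> real ^ 'm ^ 'n \<Rightarrow> real ^ 'n ^ 'n \<Rightarrow>
      real ^ 'n ^ 'm \<Rightarrow> real ^ 'n ^ 'm" where
  "riccati A B C D X \<equiv> X ** C ** X - X ** D - A ** X + B"

text \<open>The assumptions say that the block matrix \<open>K\<close> with rows \<open>[D, -C]\<close> and \<open>[-B, A]\<close> is a
  Z-matrix. They are preserved by the two symmetries used below: exchanging the two blocks of
  coordinates, which replaces \<open>(A, B, C, D)\<close> by \<open>(D, C, B, A)\<close> and leads from the equation for
  \<open>\<Phi>\<close> to that for \<open>\<Psi>\<close>, and transposing \<open>K\<close> while exchanging the blocks, which leads to the
  equation for the transpose of \<open>\<Phi>\<close>.\<close>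

locale riccati_Z =
  fixes A :: "real ^ 'm ^ 'm" and B :: "real ^ 'n ^ 'm"
    and C :: "real ^ 'm ^ 'n" and D :: "real ^ 'n ^ 'n"
  assumes Z_A: "\<And>i j. i \<noteq> j \<Longrightarrow> A $ i $ j \<le> 0"
    and Z_D: "\<And>i j. i \<noteq> j \<Longrightarrow> D $ i $ j \<le> 0"
    and B_nonneg: "0 \<le> B" and C_nonneg: "0 \<le> C"
begin

lemma swap_blocks: "riccati_Z D C B A"
  using Z_A Z_D B_nonneg C_nonneg by unfold_locales auto

lemma transpose_blocks: "riccati_Z (transpose D) (transpose B) (transpose C) (transpose A)"
  using Z_A Z_D B_nonneg C_nonneg
  by unfold_locales (simp_all only: transpose_nonneg_iff, simp_all add: transpose_def)

lemma shift_exists: "\<exists>t > 0. 0 \<le> mat t - A \<and> 0 \<le> mat t - D"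
proof -
  define t where "t = 1 + (\<Sum>i\<in>UNIV. \<bar>A $ i $ i\<bar>) + (\<Sum>i\<in>UNIV. \<bar>D $ i $ i\<bar>)"
  have A: "\<bar>A $ i $ i\<bar> \<le> (\<Sum>i\<in>UNIV. \<bar>A $ i $ i\<bar>)" for i
    by (rule member_le_sum) auto
  have D: "\<bar>D $ i $ i\<bar> \<le> (\<Sum>i\<in>UNIV. \<bar>D $ i $ i\<bar>)" for i
    by (rule member_le_sum) auto
  have nn: "0 \<le> (\<Sum>i\<in>UNIV. \<bar>A $ i $ i\<bar>)" "0 \<le> (\<Sum>i\<in>UNIV. \<bar>D $ i $ i\<bar>)"
    by (auto intro: sum_nonneg)
  have "A $ i $ i \<le> t" "D $ k $ k \<le> t" for i k
    using A[of i] D[of k] nn unfolding t_def by linarith+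
  moreover have "0 < t"
    using nn unfolding t_def by linarith
  ultimately show ?thesis
    using Z_A Z_D by (intro exI[of _ t]) (auto simp: less_eq_vec_def mat_def)
qed

text \<open>With \<open>t\<close> at least all diagonal entries of \<open>A\<close> and \<open>D\<close>, the equation is the fixed point equation
  of the monotone map \<open>G\<close> below, and the iterates of \<open>G\<close> from \<open>0\<close> increase to the minimal
  solution. The bound holds along the iteration.\<close>

lemma minimal_solution_bound:
  assumes min: "minimal_nonneg_solution (riccati A B C D) \<Phi>"
    and w: "0 \<le> w1" "0 \<le> w2" "C *v w2 \<le> D *v w1" "B *v w1 \<le> A *v w2"
  shows "\<Phi> *v w1 \<le> w2"
proof -
  from shift_exists obtain t where t: "0 < t" and tA: "0 \<le> mat t - A" and tD: "0 \<le> mat t - D"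
    by auto
  define F where
    "F X = X ** C ** X + X ** (mat t - D) + (mat t - A) ** X + B" for X :: "real ^ 'n ^ 'm"
  define G where "G X = inverse (2 * t) *\<^sub>R F X" for X
  have mat_l: "mat t ** X = t *\<^sub>R X" for X :: "real ^ 'n ^ 'm"
    by (simp add: matrix_matrix_mult_def mat_def vec_eq_iff if_distrib if_distribR cong: if_cong)
  have mat_r: "X ** mat t = t *\<^sub>R X" for X :: "real ^ 'n ^ 'm"
    by (simp add: matrix_matrix_mult_def mat_def vec_eq_iff if_distrib if_distribR cong: if_cong)
  have diff_l: "(P - Q) ** X = P ** X - Q ** X" for P Q :: "real ^ 'm ^ 'm" and X :: "real ^ 'n ^ 'm"
    by (simp add: matrix_matrix_mult_def vec_eq_iff left_diff_distrib sum_subtractf)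
  have diff_r: "X ** (P - Q) = X ** P - X ** Q" for P Q :: "real ^ 'n ^ 'n" and X :: "real ^ 'n ^ 'm"
    by (simp add: matrix_matrix_mult_def vec_eq_iff right_diff_distrib sum_subtractf)
  have F_eq: "F X = riccati A B C D X + (2 * t) *\<^sub>R X" for X
    by (simp add: F_def diff_l diff_r mat_l mat_r vec_eq_iff algebra_simps)
  have \<Phi>: "0 \<le> \<Phi>" "riccati A B C D \<Phi> = 0"
    using min by (auto simp: minimal_nonneg_solution_def)
  have G_\<Phi>: "G \<Phi> = \<Phi>"
    using t by (simp add: G_def F_eq \<Phi>(2))
  have F_mono: "F X \<le> F Y" if "0 \<le> X" "X \<le> Y" for X Y
  proof -
    have XCX: "X ** C ** X \<le> Y ** C ** Y"
      using that C_nonneg matrix_mult_mono[of 0 X 0 C]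
      by (intro matrix_mult_mono) auto
    then show ?thesis
      unfolding F_def using that tA tD by (intro add_mono XCX matrix_mult_mono) auto
  qed
  have G_mono: "G X \<le> G Y" if "0 \<le> X" "X \<le> Y" for X Y
    unfolding G_def using F_mono[OF that] t by (intro scaleR_left_mono) auto
  have G_0: "0 \<le> G 0"
    unfolding G_def F_def using B_nonneg t
    by (simp add: scaleR_nonneg_nonneg)
  define X where "X k = (G ^^ k) 0" for k
  have X_0: "X 0 = 0" and X_Suc: "X (Suc k) = G (X k)" for k
    by (simp_all add: X_def)
  have X_incr: "0 \<le> X k \<and> X k \<le> X (Suc k)" for k
    by (induction k) (use G_0 G_mono in \<open>auto simp: X_0 X_Suc intro: order_trans\<close>)
  have X_le: "X k \<le> \<Phi>" for k
  proof (induction k)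
    case (Suc k)
    then have "G (X k) \<le> G \<Phi>" using X_incr G_mono by blast
    then show ?case by (simp add: X_Suc G_\<Phi>)
  qed (simp add: X_0 \<Phi>)
  have X_bound: "X k *v w1 \<le> w2" for k
  proof (induction k)
    case 0
    then show ?case using w by (simp add: X_0)
  next
    case (Suc k)
    let ?X = "X k"
    have X_nn: "0 \<le> ?X" using X_incr by blast
    have 1: "?X *v (C *v (?X *v w1)) \<le> ?X *v (C *v w2)"
      using X_nn C_nonneg Suc by (intro matrix_vector_mult_mono)
    have 2: "?X *v (C *v w2) \<le> ?X *v (D *v w1)"
      using X_nn w by (intro matrix_vector_mult_mono)
    have 3: "(mat t - A) *v (?X *v w1) \<le> (mat t - A) *v w2"
      using tA Suc by (intro matrix_vector_mult_mono)
    have mat_v: "mat t *v x = t *\<^sub>R x" for x :: "real ^ 'm"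
      by (simp add: matrix_vector_mult_def mat_def vec_eq_iff if_distrib if_distribR cong: if_cong)
    have mat_v': "mat t *v x = t *\<^sub>R x" for x :: "real ^ 'n"
      by (simp add: matrix_vector_mult_def mat_def vec_eq_iff if_distrib if_distribR cong: if_cong)
    have "F ?X *v w1 = ?X *v (C *v (?X *v w1)) + ?X *v ((mat t - D) *v w1)
        + (mat t - A) *v (?X *v w1) + B *v w1"
      by (simp add: F_def matrix_vector_mult_add_rdistrib matrix_vector_mul_assoc matrix_mul_assoc)
    also have "\<dots> = ?X *v (C *v (?X *v w1)) + t *\<^sub>R (?X *v w1) - ?X *v (D *v w1)
        + (mat t - A) *v (?X *v w1) + B *v w1"
      by (simp add: matrix_vector_mult_diff_rdistrib matrix_vector_mult_diff_distrib mat_v'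
          matrix_vector_mult_scaleR)
    also have "\<dots> \<le> ?X *v (D *v w1) + t *\<^sub>R w2 - ?X *v (D *v w1) + (mat t - A) *v w2 + A *v w2"
      using 1 2 3 w Suc t
      by (intro add_mono diff_mono scaleR_left_mono order_refl) auto
    also have "\<dots> = (2 * t) *\<^sub>R w2"
      by (simp add: matrix_vector_mult_diff_rdistrib mat_v vec_eq_iff)
    finally have "inverse (2 * t) *\<^sub>R (F ?X *v w1) \<le> inverse (2 * t) *\<^sub>R ((2 * t) *\<^sub>R w2)"
      using t by (intro scaleR_left_mono) auto
    then show ?case
      using t by (simp add: X_Suc G_def scaleR_matrix_vector_assoc)
  qed
  have "\<exists>l. (\<lambda>k. X k $ i $ j) \<longlonglongrightarrow> l" for i j
  proof -
    have "incseq (\<lambda>k. X k $ i $ j)"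
      using X_incr by (intro incseq_SucI) (simp add: less_eq_vec_def)
    moreover have "\<forall>k. X k $ i $ j \<le> \<Phi> $ i $ j"
      using X_le by (simp add: less_eq_vec_def)
    ultimately show ?thesis
      by (metis incseq_convergent)
  qed
  then obtain l where l: "\<And>i j. (\<lambda>k. X k $ i $ j) \<longlonglongrightarrow> l i j"
    by metis
  define L where "L = (\<chi> i j. l i j)"
  have X_L: "(\<lambda>k. X k $ i $ j) \<longlonglongrightarrow> L $ i $ j" for i j
    using l by (simp add: L_def)
  then have X_lim: "X \<longlonglongrightarrow> L"
    by (intro vec_tendstoI)
  have "0 \<le> L $ i $ j" for i j
    using X_incr by (intro LIMSEQ_le_const[OF X_L]) (auto simp: less_eq_vec_def)
  then have L_nn: "0 \<le> L" by (simp add: less_eq_vec_def)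
  have "G L $ i $ j = L $ i $ j" for i j
  proof -
    have "(\<lambda>k. G (X k) $ i $ j) \<longlonglongrightarrow> G L $ i $ j"
      unfolding G_def F_def matrix_matrix_mult_def
      by (simp, intro tendsto_intros X_lim) simp
    moreover have "(\<lambda>k. G (X k) $ i $ j) \<longlonglongrightarrow> L $ i $ j"
      using LIMSEQ_Suc[OF X_L[of i j]] by (simp add: X_Suc)
    ultimately show ?thesis by (rule LIMSEQ_unique)
  qed
  then have "G L = L" by (simp add: vec_eq_iff)
  then have "(2 * t) *\<^sub>R L = F L"
    using t by (metis G_def divideR_right mult_eq_0_iff order_less_irrefl zero_neq_numeral)
  then have "riccati A B C D L = 0"
    by (simp add: F_eq)
  then have "\<Phi> \<le> L"
    using min L_nn by (auto simp: minimal_nonneg_solution_def)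
  have "(L *v w1) $ i \<le> w2 $ i" for i
  proof (rule LIMSEQ_le_const2)
    show "(\<lambda>k. (X k *v w1) $ i) \<longlonglongrightarrow> (L *v w1) $ i"
      unfolding matrix_vector_mult_def by (simp, intro tendsto_intros X_lim)
    show "\<exists>N. \<forall>k\<ge>N. (X k *v w1) $ i \<le> w2 $ i"
      using X_bound by (auto simp: less_eq_vec_def)
  qed
  then have "L *v w1 \<le> w2" by (simp add: less_eq_vec_def)
  moreover have "0 \<le> (L - \<Phi>) *v w1"
    using \<open>\<Phi> \<le> L\<close> w by (intro matrix_vector_mult_nonneg) auto
  ultimately show ?thesis
    by (simp add: matrix_vector_mult_diff_rdistrib)
qed

end

lemma minimal_solution_transpose:
  assumes "minimal_nonneg_solution (riccati A B C D) \<Phi>"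
  shows "minimal_nonneg_solution
    (riccati (transpose D) (transpose B) (transpose C) (transpose A)) (transpose \<Phi>)"
proof -
  have tr: "riccati (transpose D) (transpose B) (transpose C) (transpose A) (transpose X)
      = transpose (riccati A B C D X)" for X
    by (simp add: transpose_add transpose_diff matrix_transpose_mul matrix_mul_assoc)
  have z: "transpose X = 0 \<longleftrightarrow> X = 0" for X :: "real ^ 'a ^ 'b"
    by (simp add: transpose_def vec_eq_iff) blast
  show ?thesis
    unfolding minimal_nonneg_solution_def
  proof (intro conjI allI impI)
    show "0 \<le> transpose \<Phi>"
      using assms by (simp add: minimal_nonneg_solution_def transpose_nonneg_iff)
    show "riccati (transpose D) (transpose B) (transpose C) (transpose A) (transpose \<Phi>) = 0"
      using assms unfolding tr z by (simp add: minimal_nonneg_solution_def)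
    fix Y assume Y: "0 \<le> Y \<and> riccati (transpose D) (transpose B) (transpose C) (transpose A) Y = 0"
    then have "riccati A B C D (transpose Y) = 0"
      using tr[of "transpose Y"] by (simp add: z)
    moreover have "0 \<le> transpose Y"
      using Y by (simp add: transpose_nonneg_iff)
    ultimately have "\<Phi> \<le> transpose Y"
      using assms unfolding minimal_nonneg_solution_def by blast
    then show "transpose \<Phi> \<le> Y"
      by (metis transpose_le_iff transpose_transpose)
  qed
qed

section \<open>One-dimensional null spaces\<close>

text \<open>The null space assumptions on \<open>K\<close>, written in blocks: \<open>(v1, v2)\<close> spans the right and
  \<open>(u1, u2)\<close> the left null space. The last assumption says that \<open>K\<close> or its transpose maps some
  positive vector to a nonnegative one; unlike the first alternative alone, it is invariant under
  transposition.\<close>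

locale riccati_null = riccati_Z A B C D
  for A :: "real ^ 'm ^ 'm" and B :: "real ^ 'n ^ 'm"
    and C :: "real ^ 'm ^ 'n" and D :: "real ^ 'n ^ 'n" +
  fixes u1 v1 :: "real ^ 'n" and u2 v2 :: "real ^ 'm"
  assumes v_nonneg: "0 \<le> v1" "0 \<le> v2" and v_nonzero: "v1 \<noteq> 0 \<or> v2 \<noteq> 0"
    and u_nonneg: "0 \<le> u1" "0 \<le> u2" and u_nonzero: "u1 \<noteq> 0 \<or> u2 \<noteq> 0"
    and v_null: "D *v v1 = C *v v2" "A *v v2 = B *v v1"
    and u_null: "u1 v* D = u2 v* B" "u2 v* A = u1 v* C"
    and v_span: "\<And>x y. \<lbrakk>D *v x = C *v y; A *v y = B *v x\<rbrakk> \<Longrightarrow> \<exists>c. x = c *\<^sub>R v1 \<and> y = c *\<^sub>R v2"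
    and u_span: "\<And>x y. \<lbrakk>x v* D = y v* B; y v* A = x v* C\<rbrakk> \<Longrightarrow> \<exists>c. x = c *\<^sub>R u1 \<and> y = c *\<^sub>R u2"
    and regular:
      "(\<exists>w1 w2. (\<forall>i. 0 < w1 $ i) \<and> (\<forall>i. 0 < w2 $ i) \<and> C *v w2 \<le> D *v w1 \<and> B *v w1 \<le> A *v w2) \<or>
       (\<exists>w1 w2. (\<forall>i. 0 < w1 $ i) \<and> (\<forall>i. 0 < w2 $ i) \<and> w2 v* B \<le> w1 v* D \<and> w1 v* C \<le> w2 v* A)"
begin

lemma swap_blocks_null: "riccati_null D C B A u2 v2 u1 v1"
proof -
  interpret s: riccati_Z D C B A by (rule swap_blocks)
  show ?thesis
    by unfold_locales
      (use v_nonneg v_nonzero u_nonneg u_nonzero v_null u_null v_span u_span regular in \<open>blast+\<close>)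
qed

lemma transpose_null:
  "riccati_null (transpose D) (transpose B) (transpose C) (transpose A) v2 u2 v1 u1"
proof -
  interpret t: riccati_Z "transpose D" "transpose B" "transpose C" "transpose A"
    by (rule transpose_blocks)
  show ?thesis
    by unfold_locales
      (simp_all only: transpose_matrix_vector vector_transpose_matrix,
        (use v_nonneg v_nonzero u_nonneg u_nonzero v_null u_null v_span u_span regular in blast)+)
qed

context
  fixes \<Phi> assumes min: "minimal_nonneg_solution (riccati A B C D) \<Phi>"
begin

lemma Phi_nonneg: "0 \<le> \<Phi>" and Phi_solution: "riccati A B C D \<Phi> = 0"
  using min by (auto simp: minimal_nonneg_solution_def)

lemma Phi_apply: "B *v x - A *v (\<Phi> *v x) = \<Phi> *v (D *v x - C *v (\<Phi> *v x))"
proof -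
  have "riccati A B C D \<Phi> *v x = 0" by (simp add: Phi_solution)
  then show ?thesis
    by (simp add: matrix_vector_mult_add_rdistrib matrix_vector_mult_diff_rdistrib
        matrix_vector_mult_diff_distrib matrix_mul_assoc matrix_vector_mul_assoc algebra_simps)
qed

lemma Phi_apply_left: "x v* B - (x v* \<Phi>) v* D = (x v* A - (x v* \<Phi>) v* C) v* \<Phi>"
proof -
  have "x v* riccati A B C D \<Phi> = 0" by (simp add: Phi_solution)
  then show ?thesis
    by (simp add: vector_matrix_mult_add_rdistrib vector_matrix_mult_diff_rdistrib
        vector_matrix_mult_diff_distrib matrix_mul_assoc vector_matrix_mul_assoc algebra_simps)
qed

lemma Phi_v_le: "\<Phi> *v v1 \<le> v2"
  using minimal_solution_bound[OF min v_nonneg] v_null by simp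

lemma left_minimal_solution_bound:
  assumes "0 \<le> w1" "0 \<le> w2" "w2 v* B \<le> w1 v* D" "w1 v* C \<le> w2 v* A"
  shows "w2 v* \<Phi> \<le> w1"
  using riccati_Z.minimal_solution_bound[OF transpose_blocks minimal_solution_transpose[OF min],
      of w2 w1] assms
  by simp

lemma u_Phi_le: "u2 v* \<Phi> \<le> u1"
  using left_minimal_solution_bound[OF u_nonneg] u_null by simp

lemma singular_iff: "\<not> invertible (D - C ** \<Phi>) \<longleftrightarrow> \<Phi> *v v1 = v2"
proof
  assume "\<not> invertible (D - C ** \<Phi>)"
  then obtain x where x: "x \<noteq> 0" "(D - C ** \<Phi>) *v x = 0"
    by (auto simp: invertible_iff_kernel)
  then have "D *v x = C *v (\<Phi> *v x)"
    by (simp add: matrix_vector_mult_diff_rdistrib matrix_vector_mul_assoc)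
  moreover from this have "A *v (\<Phi> *v x) = B *v x"
    using Phi_apply[of x] by simp
  ultimately obtain c where c: "x = c *\<^sub>R v1" "\<Phi> *v x = c *\<^sub>R v2"
    using v_span by blast
  then have "c *\<^sub>R (\<Phi> *v v1) = c *\<^sub>R v2"
    by (simp add: matrix_vector_mult_scaleR)
  then show "\<Phi> *v v1 = v2"
    using c x(1) by auto
next
  assume eq: "\<Phi> *v v1 = v2"
  then have "v1 \<noteq> 0"
    using v_nonzero by auto
  moreover have "(D - C ** \<Phi>) *v v1 = 0"
    by (simp add: matrix_vector_mult_diff_rdistrib v_null eq flip: matrix_vector_mul_assoc)
  ultimately show "\<not> invertible (D - C ** \<Phi>)"
    by (auto simp: invertible_iff_kernel)
qed

lemma Z_matrix_A_minus_Phi_C: "i \<noteq> j \<Longrightarrow> (A - \<Phi> ** C) $ i $ j \<le> 0"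
  using matrix_mult_mono[of 0 \<Phi> 0 C] Phi_nonneg C_nonneg Z_A[of i j]
  by (simp add: less_eq_vec_def) (smt (verit))

text \<open>The matrix \<open>K\<close> maps the vector with blocks \<open>x, y\<close> to the one with blocks \<open>D x - C y\<close> and
  \<open>A y - B x\<close>. In the coordinates \<open>x\<close> and \<open>y - \<Phi> x\<close>, the combination below of the two output
  blocks depends on the second coordinate only, and the factor is \<open>A - \<Phi> C\<close>.\<close>

lemma A_minus_Phi_C_apply:
  "(A - \<Phi> ** C) *v (y - \<Phi> *v x) = (A *v y - B *v x) + \<Phi> *v (D *v x - C *v y)"
  using Phi_apply[of x]
  by (simp add: matrix_vector_mult_diff_rdistrib matrix_vector_mult_diff_distrib algebra_simps
      flip: matrix_vector_mul_assoc)

lemma solvable_if_orthogonal_u: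
  assumes "u1 \<bullet> b1 + u2 \<bullet> b2 = 0"
  shows "\<exists>x y. D *v x - C *v y = b1 \<and> A *v y - B *v x = b2"
proof -
  have "\<exists>z. block_matrix D (- C) (- B) A *v z = block_vec b1 b2"
  proof (rule solvable_if_orthogonal_left_kernel)
    show "block_vec u1 u2 \<bullet> block_vec b1 b2 = 0"
      using assms by (simp add: inner_block_vec)
    fix z assume "z v* block_matrix D (- C) (- B) A = 0"
    moreover obtain x y where z: "z = block_vec x y"
      by (rule block_vec_cases)
    ultimately have "x v* D = y v* B" "y v* A = x v* C"
      by (simp_all add: vector_block_matrix_mult block_vec_eq_0_iff)
    then show "\<exists>c. z = c *\<^sub>R block_vec u1 u2"
      using u_span[of x y] by (auto simp: z scaleR_block_vec)
  qed
  then obtain z where "block_matrix D (- C) (- B) A *v z = block_vec b1 b2" by blast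
  moreover obtain x y where "z = block_vec x y"
    by (rule block_vec_cases)
  ultimately show ?thesis
    by (auto simp: block_matrix_vector_mult block_vec_eq_iff)
qed

text \<open>The next two lemmas exclude \<open>u2 \<bullet> d = 0\<close> for nonzero nonnegative right and left null vectors
  \<open>d\<close> and \<open>u2\<close> of \<open>A - \<Phi> C\<close> under the two alternatives of the regularity assumption.\<close>

lemma no_null_vector_outside_support_u:
  assumes w: "\<forall>i. 0 < w1 $ i" "\<forall>i. 0 < w2 $ i" "C *v w2 \<le> D *v w1" "B *v w1 \<le> A *v w2"
    and d: "0 \<le> d" "(A - \<Phi> ** C) *v d = 0" "u2 \<bullet> d = 0"
  shows "d = 0"
proof -
  \<comment> \<open>The second block of \<open>K w\<close> may vanish where \<open>u2\<close> does. Adding to a multiple of \<open>w\<close> a vector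
    that \<open>K\<close> maps to \<open>b\<close> in the second block, and to zero in the first, makes it positive there.\<close>
  define b where "b = (\<chi> i. if u2 $ i = 0 then 1 else (0 :: real))"
  have "u1 \<bullet> 0 + u2 \<bullet> b = 0"
    by (auto simp: b_def inner_vec_def intro!: sum.neutral)
  then obtain x y where xy: "D *v x - C *v y = 0" "A *v y - B *v x = b"
    using solvable_if_orthogonal_u by blast
  obtain c1 where c1: "\<And>c. c1 \<le> c \<Longrightarrow> 0 \<le> x + c *\<^sub>R w1"
    using eventually_nonneg_add_positive[OF w(1)] by blast
  obtain c2 where c2: "\<And>c. c2 \<le> c \<Longrightarrow> 0 \<le> y + c *\<^sub>R w2"
    using eventually_nonneg_add_positive[OF w(2)] by blast
  define c where "c = max 0 (max c1 c2)"
  define e1 where "e1 = x + c *\<^sub>R w1"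
  define e2 where "e2 = y + c *\<^sub>R w2"
  have e_nn: "0 \<le> e1" "0 \<le> e2"
    unfolding e1_def e2_def by (rule c1 c2, simp add: c_def)+
  have "D *v e1 - C *v e2 = (D *v x - C *v y) + c *\<^sub>R (D *v w1 - C *v w2)"
    by (simp add: e1_def e2_def algebra_simps)
  moreover have "0 \<le> c *\<^sub>R (D *v w1 - C *v w2)"
    using w by (intro scaleR_nonneg_nonneg) (auto simp: c_def)
  ultimately have De: "0 \<le> D *v e1 - C *v e2"
    by (simp add: xy)
  have "A *v e2 - B *v e1 = (A *v y - B *v x) + c *\<^sub>R (A *v w2 - B *v w1)"
    by (simp add: e1_def e2_def algebra_simps)
  moreover have "0 \<le> c *\<^sub>R (A *v w2 - B *v w1)"
    using w by (intro scaleR_nonneg_nonneg) (auto simp: c_def)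
  ultimately have Ae: "b \<le> A *v e2 - B *v e1"
    by (simp add: xy)
  have "0 \<le> b"
    by (simp add: b_def less_eq_vec_def)
  then have "0 \<le> A *v e2 - B *v e1"
    using Ae by (rule order_trans)
  then have e: "0 \<le> e2 - \<Phi> *v e1"
    using minimal_solution_bound[OF min e_nn] De by simp
  have "b \<le> (A - \<Phi> ** C) *v (e2 - \<Phi> *v e1)"
    unfolding A_minus_Phi_C_apply using Ae matrix_vector_mult_nonneg[OF Phi_nonneg De]
    by (rule add_increasing2[rotated])
  then have "b $ i \<le> ((A - \<Phi> ** C) *v (e2 - \<Phi> *v e1)) $ i" for i
    by (simp add: less_eq_vec_def)
  moreover have "b $ i = 1" if "d $ i \<noteq> 0" for i
    using inner_nonneg_eq_0D[OF u_nonneg(2) d(1) d(3), of i] that by (simp add: b_def)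
  ultimately have "0 < ((A - \<Phi> ** C) *v (e2 - \<Phi> *v e1)) $ i" if "d $ i \<noteq> 0" for i
    using that by (metis less_le_trans zero_less_one)
  then show ?thesis
    using Z_matrix_no_kernel_on_support[OF Z_matrix_A_minus_Phi_C d(1,2) e] by blast
qed

lemma no_left_null_vector_outside_support_d:
  assumes w: "\<forall>i. 0 < w1 $ i" "\<forall>i. 0 < w2 $ i" "w2 v* B \<le> w1 v* D" "w1 v* C \<le> w2 v* A"
    and d: "0 \<le> d" "\<And>y. (A - \<Phi> ** C) *v y = 0 \<Longrightarrow> \<exists>c. y = c *\<^sub>R d"
    and u: "u2 v* (A - \<Phi> ** C) = 0" "u2 \<bullet> d = 0"
  shows "u2 = 0"
proof -
  let ?T = "A - \<Phi> ** C"
  have "0 \<le> w1" "0 \<le> w2"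
    using w by (auto simp: less_eq_vec_def intro: less_imp_le)
  then have "w2 v* \<Phi> \<le> w1"
    using left_minimal_solution_bound w by blast
  then have "transpose C *v (w2 v* \<Phi>) \<le> transpose C *v w1"
    using C_nonneg by (intro matrix_vector_mult_mono) (simp_all add: transpose_nonneg_iff)
  then have "(w2 v* \<Phi>) v* C \<le> w2 v* A"
    using w(4) by simp
  then have wT: "0 \<le> w2 v* ?T"
    by (simp add: vector_matrix_mult_diff_rdistrib vector_matrix_mul_assoc)
  define b where "b = (\<chi> i. if d $ i = 0 then 1 else (0 :: real))"
  have "d \<bullet> b = 0"
    by (auto simp: b_def inner_vec_def intro!: sum.neutral)
  then obtain y where y: "transpose ?T *v y = b"
    using solvable_if_orthogonal_left_kernel[of "transpose ?T" d b] d(2) by auto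
  obtain c0 where c0: "\<And>c. c0 \<le> c \<Longrightarrow> 0 \<le> y + c *\<^sub>R w2"
    using eventually_nonneg_add_positive[OF w(2)] by blast
  define c where "c = max 0 c0"
  have e: "0 \<le> y + c *\<^sub>R w2"
    by (rule c0) (simp add: c_def)
  have "0 \<le> c *\<^sub>R (w2 v* ?T)"
    using wT by (intro scaleR_nonneg_nonneg) (auto simp: c_def)
  then have "b \<le> transpose ?T *v (y + c *\<^sub>R w2)"
    using y by (simp add: vector_matrix_left_distrib scaleR_vector_matrix_assoc)
  then have "b $ i \<le> (transpose ?T *v (y + c *\<^sub>R w2)) $ i" for i
    by (simp add: less_eq_vec_def)
  moreover have "b $ i = 1" if "u2 $ i \<noteq> 0" for i
    using inner_nonneg_eq_0D[OF u_nonneg(2) d(1) u(2), of i] that by (simp add: b_def)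
  ultimately have "0 < (transpose ?T *v (y + c *\<^sub>R w2)) $ i" if "u2 $ i \<noteq> 0" for i
    using that by (metis less_le_trans zero_less_one)
  moreover have "transpose ?T $ i $ j \<le> 0" if "i \<noteq> j" for i j
    using Z_matrix_A_minus_Phi_C[of j i] that by (simp add: transpose_def)
  ultimately show ?thesis
    using Z_matrix_no_kernel_on_support[of "transpose ?T" u2 "y + c *\<^sub>R w2"] u_nonneg u(1) e
    by (simp only: transpose_matrix_vector) blast
qed

lemma Phi_v_eq:
  assumes drift: "u2 \<bullet> v2 \<le> u1 \<bullet> v1"
  shows "\<Phi> *v v1 = v2"
proof (rule ccontr)
  assume neq: "\<Phi> *v v1 \<noteq> v2"
  let ?R = "D - C ** \<Phi>" and ?T = "A - \<Phi> ** C"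
  define d where "d = v2 - \<Phi> *v v1"
  have inv: "invertible ?R"
    using neq singular_iff by blast
  have d: "0 \<le> d" "d \<noteq> 0"
    using Phi_v_le neq by (auto simp: d_def)
  have Td: "?T *v d = 0"
    unfolding d_def A_minus_Phi_C_apply by (simp add: v_null)
  have "transpose ?R *v (u1 - u2 v* \<Phi>) = 0"
    using Phi_apply_left[of u2]
    by (simp add: vector_matrix_mult_diff_rdistrib vector_matrix_mult_diff_distrib u_null algebra_simps
        flip: vector_matrix_mul_assoc)
  moreover have "invertible (transpose ?R)"
    using inv by (simp only: invertible_transpose_iff)
  ultimately have "u1 - u2 v* \<Phi> = 0"
    unfolding invertible_iff_kernel by blast
  then have uPhi: "u2 v* \<Phi> = u1" by simp
  have uT: "u2 v* ?T = 0"
    by (simp add: vector_matrix_mult_diff_rdistrib u_null uPhi flip: vector_matrix_mul_assoc)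
  have "u2 \<bullet> d = u2 \<bullet> v2 - u1 \<bullet> v1"
    by (simp add: d_def inner_diff_right uPhi flip: dot_lmul_matrix)
  then have ud: "u2 \<bullet> d = 0"
    using drift inner_nonneg_vec[OF u_nonneg(2) d(1)] by linarith
  have ker: "\<exists>c. y = c *\<^sub>R d" if Ty: "?T *v y = 0" for y
  proof -
    \<comment> \<open>A null vector of \<open>?T\<close> lifts to one of \<open>K\<close>, because \<open>?R\<close> is onto.\<close>
    obtain x where x: "?R *v x = C *v y"
      using inv by (metis invertible_right_inverse matrix_right_invertible_surjective surjD)
    have Dx: "D *v x = C *v (\<Phi> *v x + y)"
      using x by (simp add: matrix_vector_mult_diff_rdistrib matrix_vector_right_distrib algebra_simps
          flip: matrix_vector_mul_assoc)
    moreover have "A *v (\<Phi> *v x + y) = B *v x"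
      using A_minus_Phi_C_apply[of "\<Phi> *v x + y" x] Ty Dx by simp
    ultimately obtain c where c: "x = c *\<^sub>R v1" "\<Phi> *v x + y = c *\<^sub>R v2"
      using v_span by blast
    then have "y = c *\<^sub>R d"
      by (simp add: d_def matrix_vector_mult_scaleR scaleR_diff_right eq_diff_eq add.commute)
    then show ?thesis by blast
  qed
  from regular show False
  proof (elim disjE exE conjE)
    fix w1 w2
    assume "\<forall>i. 0 < w1 $ i" "\<forall>i. 0 < w2 $ i" "C *v w2 \<le> D *v w1" "B *v w1 \<le> A *v w2"
    then show False
      using no_null_vector_outside_support_u[OF _ _ _ _ d(1) Td ud] d(2) by blast
  next
    fix w1 w2
    assume "\<forall>i. 0 < w1 $ i" "\<forall>i. 0 < w2 $ i" "w2 v* B \<le> w1 v* D" "w1 v* C \<le> w2 v* A"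
    then have "u2 = 0"
      using no_left_null_vector_outside_support_d[OF _ _ _ _ d(1) ker uT ud] by blast
    then show False
      using uPhi u_nonzero by simp
  qed
qed

lemma Phi_v_eq_iff: "\<Phi> *v v1 = v2 \<longleftrightarrow> u2 \<bullet> v2 \<le> u1 \<bullet> v1"
proof
  assume "\<Phi> *v v1 = v2"
  then have "u2 \<bullet> v2 = (u2 v* \<Phi>) \<bullet> v1"
    by (simp add: dot_lmul_matrix)
  moreover have "0 \<le> (u1 - u2 v* \<Phi>) \<bullet> v1"
    using u_Phi_le v_nonneg by (intro inner_nonneg_vec) auto
  ultimately show "u2 \<bullet> v2 \<le> u1 \<bullet> v1"
    by (simp add: inner_diff_left)
qed (rule Phi_v_eq)

end

end

theorem theorem10:
  fixes A :: "real ^ 'm ^ 'm" and B :: "real ^ 'n ^ 'm"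
    and C :: "real ^ 'm ^ 'n" and D :: "real ^ 'n ^ 'n"
    and K :: "real ^ ('n + 'm) ^ ('n + 'm)"
    and u1 v1 :: "real ^ 'n" and u2 v2 :: "real ^ 'm"
    and \<Phi> :: "real ^ 'n ^ 'm" and \<Psi> :: "real ^ 'm ^ 'n"
  assumes K_def: "K = block_matrix D (- C) (- B) A"
    and regular: "regular_M_matrix K"
    and singular: "singular_M_matrix K"
    and null_space: "dim {x. K *v x = 0} = 1"
    and u: "0 \<le> block_vec u1 u2" "block_vec u1 u2 \<noteq> 0" "block_vec u1 u2 v* K = 0"
    and v: "0 \<le> block_vec v1 v2" "block_vec v1 v2 \<noteq> 0" "K *v block_vec v1 v2 = 0"
    and Phi: "minimal_nonneg_solution (\<lambda>X. X ** C ** X - X ** D - A ** X + B) \<Phi>"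
    and Psi: "minimal_nonneg_solution (\<lambda>Y. Y ** B ** Y - Y ** A - D ** Y + C) \<Psi>"
  shows "(u1 \<bullet> v1 > u2 \<bullet> v2 \<longrightarrow>
            \<not> invertible (D - C ** \<Phi>) \<and> invertible (A - \<Phi> ** C) \<and>
            \<Phi> *v v1 = v2 \<and> \<Psi> *v v2 \<noteq> v1 \<and> u1 v* \<Psi> = u2 \<and> u2 v* \<Phi> \<noteq> u1) \<and>
         (u1 \<bullet> v1 < u2 \<bullet> v2 \<longrightarrow>
            invertible (D - C ** \<Phi>) \<and> \<not> invertible (A - \<Phi> ** C) \<and>
            \<Phi> *v v1 \<noteq> v2 \<and> \<Psi> *v v2 = v1 \<and> u1 v* \<Psi> \<noteq> u2 \<and> u2 v* \<Phi> = u1) \<and>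
         (u1 \<bullet> v1 = u2 \<bullet> v2 \<longrightarrow>
            \<not> invertible (D - C ** \<Phi>) \<and> \<not> invertible (A - \<Phi> ** C) \<and>
            \<Phi> *v v1 = v2 \<and> \<Psi> *v v2 = v1 \<and> u1 v* \<Psi> = u2 \<and> u2 v* \<Phi> = u1)"
proof -
  have K_Z: "K $ i $ j \<le> 0" if "i \<noteq> j" for i j
  proof -
    obtain s N where "0 \<le> N" "K = mat s - N"
      using regular by (auto simp: regular_M_matrix_def M_matrix_def)
    then show ?thesis
      using that by (simp add: less_eq_vec_def mat_def)
  qed
  have Z: "riccati_Z A B C D"
  proof
    show "A $ i $ j \<le> 0" if "i \<noteq> j" for i j
      using K_Z[of "Inr i" "Inr j"] that by (simp add: K_def block_matrix_def)
    show "D $ i $ j \<le> 0" if "i \<noteq> j" for i j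
      using K_Z[of "Inl i" "Inl j"] that by (simp add: K_def block_matrix_def)
    show "0 \<le> B"
      using K_Z[of "Inr _" "Inl _"] by (simp add: K_def block_matrix_def less_eq_vec_def)
    show "0 \<le> C"
      using K_Z[of "Inl _" "Inr _"] by (simp add: K_def block_matrix_def less_eq_vec_def)
  qed
  obtain w where w: "\<forall>i. 0 < w $ i" "0 \<le> K *v w"
    using regular by (auto simp: regular_M_matrix_def)
  obtain w1 w2 where w_eq: "w = block_vec w1 w2"
    by (rule block_vec_cases)
  have w_pos: "\<forall>i. 0 < w1 $ i" "\<forall>i. 0 < w2 $ i"
    using w(1) by (simp_all add: w_eq all_sum_iff)
  have w_super: "C *v w2 \<le> D *v w1" "B *v w1 \<le> A *v w2"
    using w(2) by (simp_all add: w_eq K_def block_matrix_vector_mult block_vec_nonneg_iff)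
  have v_span: "\<exists>c. x = c *\<^sub>R v1 \<and> y = c *\<^sub>R v2" if "D *v x = C *v y" "A *v y = B *v x" for x y
  proof -
    have "K *v block_vec x y = 0"
      using that by (simp add: K_def block_matrix_vector_mult block_vec_eq_0_iff)
    then have "\<exists>c. block_vec x y = c *\<^sub>R block_vec v1 v2"
      using v by (intro dim_1_multiple[OF null_space]) auto
    then show ?thesis
      by (simp add: scaleR_block_vec block_vec_eq_iff)
  qed
  have left_null_space: "dim {x. x v* K = 0} = 1"
    using null_space by (simp add: dim_kernel_eq_transpose)
  have u_span: "\<exists>c. x = c *\<^sub>R u1 \<and> y = c *\<^sub>R u2" if "x v* D = y v* B" "y v* A = x v* C" for x y
  proof -
    have "block_vec x y v* K = 0"
      using that by (simp add: K_def vector_block_matrix_mult block_vec_eq_0_iff)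
    then have "\<exists>c. block_vec x y = c *\<^sub>R block_vec u1 u2"
      using u by (intro dim_1_multiple[OF left_null_space]) auto
    then show ?thesis
      by (simp add: scaleR_block_vec block_vec_eq_iff)
  qed
  interpret P: riccati_null A B C D u1 v1 u2 v2
  proof (rule riccati_null.intro[OF Z], unfold_locales)
    show "0 \<le> v1" "0 \<le> v2" "0 \<le> u1" "0 \<le> u2"
      using u v by (simp_all add: block_vec_nonneg_iff)
    show "v1 \<noteq> 0 \<or> v2 \<noteq> 0" "u1 \<noteq> 0 \<or> u2 \<noteq> 0"
      using u v by (auto simp: block_vec_eq_0_iff)
    show "D *v v1 = C *v v2" "A *v v2 = B *v v1"
      using v(3) by (simp_all add: K_def block_matrix_vector_mult block_vec_eq_0_iff)
    show "u1 v* D = u2 v* B" "u2 v* A = u1 v* C"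
      using u(3) by (simp_all add: K_def vector_block_matrix_mult block_vec_eq_0_iff)
  qed (use v_span u_span w_pos w_super in blast)+
  interpret Pt: riccati_null "transpose D" "transpose B" "transpose C" "transpose A" v2 u2 v1 u1
    by (rule P.transpose_null)
  interpret Q: riccati_null D C B A u2 v2 u1 v1
    by (rule P.swap_blocks_null)
  interpret Qt: riccati_null "transpose A" "transpose C" "transpose B" "transpose D" v1 u1 v2 u2
    by (rule Q.transpose_null)
  note Phi_t = minimal_solution_transpose[OF Phi]
  note Psi_t = minimal_solution_transpose[OF Psi]
  have "\<Phi> *v v1 = v2 \<longleftrightarrow> u2 \<bullet> v2 \<le> u1 \<bullet> v1"
    by (rule P.Phi_v_eq_iff[OF Phi])
  moreover have "u2 v* \<Phi> = u1 \<longleftrightarrow> u1 \<bullet> v1 \<le> u2 \<bullet> v2"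
    using Pt.Phi_v_eq_iff[OF Phi_t] by (simp add: inner_commute)
  moreover have "\<Psi> *v v2 = v1 \<longleftrightarrow> u1 \<bullet> v1 \<le> u2 \<bullet> v2"
    by (rule Q.Phi_v_eq_iff[OF Psi])
  moreover have "u1 v* \<Psi> = u2 \<longleftrightarrow> u2 \<bullet> v2 \<le> u1 \<bullet> v1"
    using Qt.Phi_v_eq_iff[OF Psi_t] by (simp add: inner_commute)
  moreover have "invertible (D - C ** \<Phi>) \<longleftrightarrow> \<Phi> *v v1 \<noteq> v2"
    using P.singular_iff[OF Phi] by blast
  moreover have "invertible (A - \<Phi> ** C) \<longleftrightarrow> u2 v* \<Phi> \<noteq> u1"
    using Pt.singular_iff[OF Phi_t] invertible_transpose_iff[of "A - \<Phi> ** C"]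
    by (simp add: transpose_diff matrix_transpose_mul) blast
  ultimately show ?thesis
    by auto
qed

end
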